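(* Assume that $z,w\in A_1$ with $[z,w]=1$. If $z\in D_{\ge -1}$, then $z$ and $w$ generate $A_1$ (as a $K$-algebra).
   Context: $K$ is a field of characteristic $0$. $A_1$ is the first Weyl algebra over $K$, i.e. the associative unital $K$-algebra generated by $p,q$ subject to $pq-qp=1$; the elements $p^iq^j$ ($i,j\in\mathbb{Z}_{\ge0}$) form a $K$-basis. $[a,b]=ab-ba$. For $t\in\mathbb{Z}$, $D_t=\mathrm{Span}_K\{p^iq^s : i,s\ge 0,\ s-i=t\}$, and $D_{\ge -1}=\bigoplus_{t\ge -1}D_t$. *)

theory Defs
  imports "HOL-Computational_Algebra.Polynomial"
begin

text \<open>
  The first Weyl algebra over a field is constructed from its presentation: the terms built from
  two generators and scalars, modulo the least congruence that contains the laws of an associative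
  unital algebra and the defining relation. A scalar \<open>c\<close> multiplies a term as the central constant
  \<open>c\<close>; in particular \<open>Const (-1)\<close> provides negatives.
\<close>

datatype 'k weyl_term =
    Gen_P
  | Gen_Q
  | Const 'k
  | Plus "'k weyl_term" "'k weyl_term"
  | Times "'k weyl_term" "'k weyl_term"

inductive weyl_eq :: "'k::field weyl_term \<Rightarrow> 'k weyl_term \<Rightarrow> bool" where
  refl: "weyl_eq a a"
| sym: "weyl_eq a b \<Longrightarrow> weyl_eq b a"
| trans: "weyl_eq a b \<Longrightarrow> weyl_eq b c \<Longrightarrow> weyl_eq a c"
| plus_cong: "weyl_eq a a' \<Longrightarrow> weyl_eq b b' \<Longrightarrow> weyl_eq (Plus a b) (Plus a' b')"
| times_cong: "weyl_eq a a' \<Longrightarrow> weyl_eq b b' \<Longrightarrow> weyl_eq (Times a b) (Times a' b')"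
| plus_assoc: "weyl_eq (Plus (Plus a b) c) (Plus a (Plus b c))"
| plus_commute: "weyl_eq (Plus a b) (Plus b a)"
| plus_zero: "weyl_eq (Plus (Const 0) a) a"
| plus_minus: "weyl_eq (Plus (Times (Const (- 1)) a) a) (Const 0)"
| times_assoc: "weyl_eq (Times (Times a b) c) (Times a (Times b c))"
| times_one: "weyl_eq (Times (Const 1) a) a"
| distrib_right: "weyl_eq (Times (Plus a b) c) (Plus (Times a c) (Times b c))"
| distrib_left: "weyl_eq (Times a (Plus b c)) (Plus (Times a b) (Times a c))"
| const_plus: "weyl_eq (Const (x + y)) (Plus (Const x) (Const y))"
| const_times: "weyl_eq (Const (x * y)) (Times (Const x) (Const y))"
| const_central: "weyl_eq (Times (Const x) a) (Times a (Const x))"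
| relation: "weyl_eq (Times Gen_P Gen_Q) (Plus (Times Gen_Q Gen_P) (Const 1))"

text \<open>
  The action by differential operators on polynomials, \<open>p\<close> as the derivative and \<open>q\<close> as
  multiplication by the variable, shows that the quotient is not the zero ring.
\<close>

primrec weyl_act :: "'k::field weyl_term \<Rightarrow> 'k poly \<Rightarrow> 'k poly" where
  "weyl_act Gen_P f = pderiv f"
| "weyl_act Gen_Q f = pCons 0 f"
| "weyl_act (Const c) f = smult c f"
| "weyl_act (Plus a b) f = weyl_act a f + weyl_act b f"
| "weyl_act (Times a b) f = weyl_act a (weyl_act b f)"

lemma weyl_act_add: "weyl_act a (f + g) = weyl_act a f + weyl_act a g"
  by (induction a arbitrary: f g) (simp_all add: pderiv_add smult_add_right)

lemma weyl_act_smult: "weyl_act a (smult c f) = smult c (weyl_act a f)"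
  by (induction a arbitrary: f) (simp_all add: pderiv_smult smult_add_right mult.commute)

lemma weyl_act_cong: "weyl_eq a b \<Longrightarrow> weyl_act a f = weyl_act b f"
  by (induction arbitrary: f rule: weyl_eq.induct)
    (simp_all add: weyl_act_add weyl_act_smult smult_add_left pderiv_pCons add_ac mult.commute)

quotient_type (overloaded) 'k weyl = "'k::field weyl_term" / weyl_eq
  by (rule equivpI) (auto intro: reflpI sympI transpI weyl_eq.refl weyl_eq.sym weyl_eq.trans)

instantiation weyl :: (field) ring_1
begin

lift_definition zero_weyl :: "'a weyl" is "Const 0" .
lift_definition one_weyl :: "'a weyl" is "Const 1" .
lift_definition plus_weyl :: "'a weyl \<Rightarrow> 'a weyl \<Rightarrow> 'a weyl" is Plus
  by (rule weyl_eq.plus_cong)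
lift_definition times_weyl :: "'a weyl \<Rightarrow> 'a weyl \<Rightarrow> 'a weyl" is Times
  by (rule weyl_eq.times_cong)
lift_definition uminus_weyl :: "'a weyl \<Rightarrow> 'a weyl" is "Times (Const (- 1))"
  by (rule weyl_eq.times_cong[OF weyl_eq.refl])
definition minus_weyl :: "'a weyl \<Rightarrow> 'a weyl \<Rightarrow> 'a weyl" where
  "minus_weyl a b = a + - b"

instance
proof
  fix a b c :: "'a weyl"
  show "a + b + c = a + (b + c)" by transfer (rule weyl_eq.plus_assoc)
  show "a + b = b + a" by transfer (rule weyl_eq.plus_commute)
  show "0 + a = a" by transfer (rule weyl_eq.plus_zero)
  show "- a + a = 0" by transfer (rule weyl_eq.plus_minus)
  show "a - b = a + - b" by (rule minus_weyl_def)
  show "a * b * c = a * (b * c)" by transfer (rule weyl_eq.times_assoc)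
  show "1 * a = a" by transfer (rule weyl_eq.times_one)
  show "a * 1 = a" by transfer (rule weyl_eq.trans[OF weyl_eq.sym[OF weyl_eq.const_central] weyl_eq.times_one])
  show "(a + b) * c = a * c + b * c" by transfer (rule weyl_eq.distrib_right)
  show "a * (b + c) = a * b + a * c" by transfer (rule weyl_eq.distrib_left)
  show "(0::'a weyl) \<noteq> 1"
  proof (transfer, rule notI)
    assume "weyl_eq (Const 0) (Const (1::'a))"
    from weyl_act_cong[OF this, of 1] show False by simp
  qed
qed

end

lift_definition weyl_p :: "'k::field weyl" is Gen_P .

lift_definition weyl_q :: "'k::field weyl" is Gen_Q .

lift_definition weyl_const :: "'k::field \<Rightarrow> 'k weyl" is Const .

definition weyl_scale :: "'k::field \<Rightarrow> 'k weyl \<Rightarrow> 'k weyl" where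
  "weyl_scale c a = weyl_const c * a"

lemma weyl_relation: "weyl_p * weyl_q - weyl_q * weyl_p = (1 :: 'k::field weyl)"
proof -
  have "weyl_p * weyl_q = weyl_q * weyl_p + (1 :: 'k weyl)"
    by transfer (rule weyl_eq.relation)
  then show ?thesis by simp
qed

lemma weyl_const_one: "weyl_const 1 = 1"
  by transfer (rule weyl_eq.refl)

lemma weyl_const_add: "weyl_const (x + y) = weyl_const x + weyl_const y"
  by transfer (rule weyl_eq.const_plus)

lemma weyl_const_mult: "weyl_const (x * y) = weyl_const x * weyl_const y"
  by transfer (rule weyl_eq.const_times)

lemma weyl_const_central: "weyl_const x * a = a * weyl_const x"
  by transfer (rule weyl_eq.const_central)

global_interpretation weyl: vector_space "weyl_scale :: 'k::field \<Rightarrow> 'k weyl \<Rightarrow> 'k weyl"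
  by unfold_locales
    (simp_all add: weyl_scale_def weyl_const_one weyl_const_add weyl_const_mult algebra_simps)

definition weyl_D :: "int \<Rightarrow> 'k::field weyl set" where
  "weyl_D t = weyl.span {weyl_p ^ i * weyl_q ^ s | i s. int s - int i = t}"

text \<open>
  The sum of the subspaces \<open>weyl_D t\<close> is rendered as the span of their union. That it is direct is a
  consequence of the monomials \<open>p ^ i * q ^ s\<close> being linearly independent.
\<close>

definition weyl_D_ge :: "int \<Rightarrow> 'k::field weyl set" where
  "weyl_D_ge m = weyl.span (\<Union>t\<in>{m..}. weyl_D t)"

definition weyl_subalgebra :: "'k::field weyl set \<Rightarrow> bool" where
  "weyl_subalgebra S \<longleftrightarrow> weyl.subspace S \<and> 1 \<in> S \<and> (\<forall>a\<in>S. \<forall>b\<in>S. a * b \<in> S)"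

definition weyl_generate :: "'k::field weyl set \<Rightarrow> 'k weyl set" where
  "weyl_generate G = weyl_subalgebra hull G"

end

theory Submission
  imports Defs
begin

text \<open>
  Every element of the Weyl algebra is a unique combination of the monomials \<open>p^i q^j\<close>, and a
  monomial is placed at the lattice point \<open>(i, j)\<close>. The commutator of two monomials is
  \<open>(il - jk) p^(i+k-1) q^(j+l-1)\<close> plus terms further down the diagonal. So whenever a linear weight
  \<open>\<alpha> i + \<gamma> j\<close> with \<open>\<alpha> + \<gamma> \<ge> 0\<close> (ties broken by \<open>i\<close>) singles out leading monomials \<open>(i, j)\<close> of \<open>z\<close>
  and \<open>(k, l)\<close> of \<open>w\<close> with \<open>il \<noteq> jk\<close>, the leading term of \<open>[z, w]\<close> is read off, and \<open>[z, w] = 1\<close> forces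
  \<open>(i + k, j + l) = (1, 1)\<close>. This is \<open>leading_commutator_one\<close>; everything else is a choice of weights.

  Call \<open>j - i\<close> the degree of \<open>p^i q^j\<close>, so that all monomials of \<open>z\<close> have degree at least \<open>-1\<close>. The
  weight \<open>(1, -1)\<close> looks at the lowest degree part. If \<open>z\<close> has a part of degree \<open>-1\<close>, then, as long as
  \<open>w\<close> has a monomial of degree at most \<open>0\<close>, the leading exponents of \<open>w\<close> are a multiple of those of
  \<open>z\<close>; subtracting a scalar multiple of a power of \<open>z\<close> from \<open>w\<close> changes neither the commutator nor the
  generated algebra and lowers the leading monomial of \<open>w\<close>. The process stops with \<open>w\<close> having only
  degrees at least \<open>1\<close>. If \<open>z\<close> has no part of degree \<open>-1\<close>, then after removing its constant term it has
  only degrees at least \<open>1\<close> and \<open>w\<close> has only degrees at least \<open>-1\<close>. In both cases the algebra contains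
  a pair \<open>P, Q\<close> with \<open>[P, Q] = 1\<close>, where \<open>P\<close> has degrees at least \<open>-1\<close> and \<open>Q\<close> has degrees at least \<open>1\<close>.

  For such a pair the monomials \<open>p\<close> of \<open>P\<close> and \<open>q\<close> of \<open>Q\<close> do occur. Rotate the weight from \<open>(1, -1)\<close>
  towards \<open>(1, 0)\<close>. At the first direction where another monomial ties with \<open>p\<close> or with \<open>q\<close>, the tie-break
  moves a leading monomial away from \<open>(1, 0)\<close> or \<open>(0, 1)\<close>, while \<open>il > jk\<close> still holds; this was excluded. So no such
  direction exists: \<open>P\<close> has degree at most one in \<open>p\<close>, and \<open>Q\<close> does not involve \<open>p\<close>
  (\<open>commutator_one_p_degree\<close>). One more weight gives \<open>P = c p + f(q)\<close> and \<open>Q = d q\<close> with \<open>c, d\<close> nonzero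
  (\<open>commutator_one_triangular\<close>), and these generate \<open>q\<close>, then \<open>f(q)\<close>, then \<open>p\<close>.
\<close>

section \<open>Coefficients in the monomial basis\<close>

text \<open>
  This is left multiplication of the Weyl algebra on itself, in normally ordered coordinates: functions
  on exponents are read as polynomials in commuting variables \<open>x\<close> (for \<open>p\<close>) and \<open>y\<close> (for \<open>q\<close>), with
  \<open>p\<close> acting as multiplication by \<open>x\<close> and \<open>q\<close> as \<open>y - d/dx\<close>, the correction coming from
  \<open>q p^n = p^n q - n p^(n-1)\<close>. All functions are allowed, so no finiteness has to be carried along.
\<close>

primrec symbol_act :: "'k::field weyl_term \<Rightarrow> (nat \<times> nat \<Rightarrow> 'k) \<Rightarrow> nat \<times> nat \<Rightarrow> 'k" where
  "symbol_act Gen_P f = (\<lambda>(i, j). if i = 0 then 0 else f (i - 1, j))"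
| "symbol_act Gen_Q f =
     (\<lambda>(i, j). (if j = 0 then 0 else f (i, j - 1)) - of_nat (i + 1) * f (i + 1, j))"
| "symbol_act (Const c) f = (\<lambda>x. c * f x)"
| "symbol_act (Plus a b) f = (\<lambda>x. symbol_act a f x + symbol_act b f x)"
| "symbol_act (Times a b) f = symbol_act a (symbol_act b f)"

lemma symbol_act_add:
  "symbol_act a (\<lambda>x. f x + g x) = (\<lambda>x. symbol_act a f x + symbol_act a g x)"
proof (induction a arbitrary: f g)
  case (Times a b)
  then show ?case by simp
qed (auto simp: fun_eq_iff algebra_simps)

lemma symbol_act_smult: "symbol_act a (\<lambda>x. c * f x) = (\<lambda>x. c * symbol_act a f x)"
proof (induction a arbitrary: f)
  case (Times a b)
  then show ?case by simp
qed (auto simp: fun_eq_iff algebra_simps)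

lemma symbol_act_cong: "weyl_eq a b \<Longrightarrow> symbol_act a f = symbol_act b f"
proof (induction arbitrary: f rule: weyl_eq.induct)
  case relation
  show ?case
    by (auto simp: fun_eq_iff algebra_simps of_nat_diff)
qed (simp_all add: symbol_act_add symbol_act_smult algebra_simps)

text \<open>
  Applying an element to the constant polynomial \<open>1\<close> returns its normally ordered symbol, because
  \<open>p^i q^j\<close> sends \<open>1\<close> to \<open>x^i y^j\<close>. Coefficients defined in this way are well defined on the quotient
  at once, and their values on monomials show that the monomials are linearly independent.
\<close>

lift_definition weyl_coeff :: "'k::field weyl \<Rightarrow> nat \<times> nat \<Rightarrow> 'k"
  is "\<lambda>a. symbol_act a (\<lambda>x. if x = (0, 0) then 1 else 0)"
  by (rule symbol_act_cong)

lemma weyl_coeff_zero [simp]: "weyl_coeff 0 x = 0"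
  by transfer simp

lemma weyl_coeff_one: "weyl_coeff 1 x = (if x = (0, 0) then 1 else 0)"
  by transfer simp

lemma weyl_coeff_add: "weyl_coeff (a + b) x = weyl_coeff a x + weyl_coeff b x"
  by transfer simp

lemma weyl_coeff_minus: "weyl_coeff (- a) x = - weyl_coeff a x"
  by transfer simp

lemma weyl_coeff_diff: "weyl_coeff (a - b) x = weyl_coeff a x - weyl_coeff b x"
  by (metis weyl_coeff_add weyl_coeff_minus diff_conv_add_uminus)

lemma weyl_coeff_scale: "weyl_coeff (weyl_scale c a) x = c * weyl_coeff a x"
  unfolding weyl_scale_def by transfer simp

lemma weyl_coeff_sum: "weyl_coeff (\<Sum>x\<in>A. f x) y = (\<Sum>x\<in>A. weyl_coeff (f x) y)"
  by (induction A rule: infinite_finite_induct) (simp_all add: weyl_coeff_add)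

lemma weyl_coeff_p_times:
  "weyl_coeff (weyl_p * a) (i, j) = (if i = 0 then 0 else weyl_coeff a (i - 1, j))"
  by transfer simp

lemma weyl_coeff_q_times:
  "weyl_coeff (weyl_q * a) (i, j) =
     (if j = 0 then 0 else weyl_coeff a (i, j - 1)) - of_nat (i + 1) * weyl_coeff a (i + 1, j)"
  by transfer simp

lemma weyl_coeff_p_power_times:
  "weyl_coeff (weyl_p ^ n * a) (i, j) = (if i < n then 0 else weyl_coeff a (i - n, j))"
  by (induction n arbitrary: i) (auto simp: mult.assoc weyl_coeff_p_times)

lemma weyl_coeff_q_power: "weyl_coeff (weyl_q ^ n) x = (if x = (0, n) then 1 else 0)"
proof (induction n arbitrary: x)
  case (Suc n)
  then show ?case by (cases x) (auto simp: weyl_coeff_q_times)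
qed (simp add: weyl_coeff_one)

definition weyl_monom :: "nat \<times> nat \<Rightarrow> 'k::field weyl" where
  "weyl_monom x = weyl_p ^ fst x * weyl_q ^ snd x"

lemma weyl_coeff_monom: "weyl_coeff (weyl_monom x) y = (if y = x then 1 else 0)"
  by (cases x; cases y)
    (auto simp: weyl_monom_def weyl_coeff_p_power_times weyl_coeff_q_power)

lemma weyl_scale_mult_left: "weyl_scale c a * b = weyl_scale c (a * b)"
  by (simp add: weyl_scale_def mult.assoc)

lemma weyl_scale_mult_right: "a * weyl_scale c b = weyl_scale c (a * b)"
  by (metis weyl_scale_def mult.assoc weyl_const_central)

text \<open>
  Induction over terms: every constructor of terms is a generator, a scalar, or an algebra operation.
\<close>

lemma subalgebra_generated_by_p_q:
  assumes S: "weyl_subalgebra S" and p: "weyl_p \<in> S" and q: "weyl_q \<in> S"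
  shows "S = (UNIV :: 'k::field weyl set)"
proof -
  have "abs_weyl t \<in> S" for t :: "'k weyl_term"
  proof (induction t)
    case Gen_P
    then show ?case using p by (simp add: weyl_p_def)
  next
    case Gen_Q
    then show ?case using q by (simp add: weyl_q_def)
  next
    case (Const c)
    have "abs_weyl (Const c) = weyl_scale c 1"
      by (simp add: weyl_scale_def weyl_const_def)
    then show ?case using S by (simp add: weyl_subalgebra_def weyl.subspace_scale)
  next
    case (Plus a b)
    then show ?case using S
      by (metis plus_weyl.abs_eq weyl_subalgebra_def weyl.subspace_add)
  next
    case (Times a b)
    then show ?case using S by (metis times_weyl.abs_eq weyl_subalgebra_def)
  qed
  then have "x \<in> S" for x
    by (metis Quotient_weyl Quotient_abs_rep)
  then show ?thesis by auto
qed

text \<open>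
  The span is closed under left multiplication by \<open>p\<close>, and, moving \<open>q\<close> past one \<open>p\<close> at a time by
  \<open>q p = p q - 1\<close>, also by \<open>q\<close>; hence it is a subalgebra that contains both generators.
\<close>

lemma span_weyl_monom: "weyl.span (range weyl_monom) = (UNIV :: 'k::field weyl set)"
proof (rule subalgebra_generated_by_p_q)
  let ?S = "weyl.span (range weyl_monom) :: 'k weyl set"
  have monom: "weyl_p ^ i * weyl_q ^ j \<in> ?S" for i j
    by (rule weyl.span_base) (auto simp: weyl_monom_def image_iff)
  have p: "weyl_p * a \<in> ?S" if "a \<in> ?S" for a
    using that
  proof (induction rule: weyl.span_induct_alt)
    case (step c x y)
    from step(1) obtain i j where x: "x = weyl_p ^ i * weyl_q ^ j"
      by (auto simp: weyl_monom_def)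
    have "weyl_p * (weyl_scale c x + y) = weyl_scale c (weyl_p * x) + weyl_p * y"
      by (simp add: ring_distribs weyl_scale_mult_right)
    moreover have "weyl_p * x \<in> ?S"
      using monom[of "Suc i" j] by (simp add: x mult.assoc)
    ultimately show ?case using step(2) by (metis weyl.span_add weyl.span_scale)
  qed (simp add: weyl.span_zero)
  have q_monom: "weyl_q * (weyl_p ^ i * weyl_q ^ j) \<in> ?S" for i j
  proof (induction i)
    case 0
    then show ?case using monom[of 0 "Suc j"] by simp
  next
    case (Suc i)
    have qp: "weyl_q * weyl_p = weyl_p * weyl_q - (1 :: 'k weyl)"
      using weyl_relation[where 'k = 'k] by (simp add: algebra_simps)
    have "weyl_q * (weyl_p ^ Suc i * weyl_q ^ j) =
        (weyl_q * weyl_p) * (weyl_p ^ i * weyl_q ^ j :: 'k weyl)"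
      by (simp add: mult.assoc)
    also have "\<dots> = weyl_p * (weyl_q * (weyl_p ^ i * weyl_q ^ j)) - weyl_p ^ i * weyl_q ^ j"
      unfolding qp by (simp add: left_diff_distrib mult.assoc)
    finally show ?case using p[OF Suc] monom weyl.span_diff by metis
  qed
  have q: "weyl_q * a \<in> ?S" if "a \<in> ?S" for a
    using that
  proof (induction rule: weyl.span_induct_alt)
    case (step c x y)
    from step(1) obtain i j where x: "x = weyl_p ^ i * weyl_q ^ j"
      by (auto simp: weyl_monom_def)
    have "weyl_q * (weyl_scale c x + y) = weyl_scale c (weyl_q * x) + weyl_q * y"
      by (simp add: ring_distribs weyl_scale_mult_right)
    then show ?case using step(2) q_monom x by (metis weyl.span_add weyl.span_scale)
  qed (simp add: weyl.span_zero)
  have p_pow: "weyl_p ^ i * a \<in> ?S" if "a \<in> ?S" for i a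
    using that p by (induction i) (simp_all add: mult.assoc)
  have q_pow: "weyl_q ^ i * a \<in> ?S" if "a \<in> ?S" for i a
    using that q by (induction i) (simp_all add: mult.assoc)
  have mult: "a * b \<in> ?S" if "a \<in> ?S" "b \<in> ?S" for a b
    using that(1)
  proof (induction rule: weyl.span_induct_alt)
    case (step c x y)
    from step(1) obtain i j where x: "x = weyl_p ^ i * weyl_q ^ j"
      by (auto simp: weyl_monom_def)
    have "(weyl_scale c x + y) * b = weyl_scale c (weyl_p ^ i * (weyl_q ^ j * b)) + y * b"
      by (simp add: x ring_distribs weyl_scale_mult_left mult.assoc)
    then show ?case using step(2) p_pow[OF q_pow[OF that(2)]]
      by (metis weyl.span_add weyl.span_scale)
  qed (simp add: weyl.span_zero)
  show "weyl_subalgebra ?S"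
    using monom[of 0 0] mult by (simp add: weyl_subalgebra_def weyl.subspace_span)
  show "weyl_p \<in> ?S" using monom[of 1 0] by simp
  show "weyl_q \<in> ?S" using monom[of 0 1] by simp
qed

definition weyl_supp :: "'k::field weyl \<Rightarrow> (nat \<times> nat) set" where
  "weyl_supp a = {x. weyl_coeff a x \<noteq> 0}"

lemma mem_weyl_supp: "x \<in> weyl_supp a \<longleftrightarrow> weyl_coeff a x \<noteq> 0"
  by (simp add: weyl_supp_def)

text \<open>
  The scalars in an expansion are recovered as coefficients, so the expansion can be taken over the support.
\<close>

lemma weyl_expansion:
  fixes a :: "'k::field weyl"
  shows "finite (weyl_supp a) \<and> a = (\<Sum>x\<in>weyl_supp a. weyl_scale (weyl_coeff a x) (weyl_monom x))"
proof -
  have "a \<in> weyl.span (range weyl_monom)" unfolding span_weyl_monom by (rule UNIV_I)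
  then obtain t r where t: "finite t" "t \<subseteq> range weyl_monom" and a: "a = (\<Sum>b\<in>t. weyl_scale (r b) b)"
    unfolding weyl.span_explicit
    by (elim CollectE exE conjE)
  obtain A where A: "inj_on (weyl_monom :: _ \<Rightarrow> 'k weyl) A" "t = weyl_monom ` A"
    using subset_image_inj[THEN iffD1, OF t(2)] by (elim exE conjE)
  have fin: "finite A"
    using finite_imageD[OF _ A(1)] t(1) A(2) by simp
  have a': "a = (\<Sum>x\<in>A. weyl_scale (r (weyl_monom x)) (weyl_monom x))"
    unfolding a A(2) by (simp add: sum.reindex A(1))
  have c: "weyl_coeff a x = (if x \<in> A then r (weyl_monom x) else 0)" for x
  proof -
    have "weyl_coeff a x = (\<Sum>y\<in>A. if x = y then r (weyl_monom y) else 0)"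
      by (subst a', unfold weyl_coeff_sum, rule sum.cong)
        (auto simp: weyl_coeff_scale weyl_coeff_monom)
    then show ?thesis using fin by simp
  qed
  have sub: "weyl_supp a \<subseteq> A" by (auto simp: weyl_supp_def c)
  have "a = (\<Sum>x\<in>A. weyl_scale (weyl_coeff a x) (weyl_monom x))"
    by (subst a', rule sum.cong) (simp_all add: c)
  also have "\<dots> = (\<Sum>x\<in>weyl_supp a. weyl_scale (weyl_coeff a x) (weyl_monom x))"
    by (rule sum.mono_neutral_right) (use fin sub in \<open>auto simp: weyl_supp_def\<close>)
  finally show ?thesis using sub fin finite_subset by blast
qed

lemmas finite_weyl_supp = conjunct1[OF weyl_expansion]
lemmas weyl_sum_supp = conjunct2[OF weyl_expansion]

lemma weyl_coeff_mult:
  "weyl_coeff (a * b) u = (\<Sum>x\<in>weyl_supp a. \<Sum>y\<in>weyl_supp b.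
     weyl_coeff a x * weyl_coeff b y * weyl_coeff (weyl_monom x * weyl_monom y) u)"
proof -
  have "a * b = (\<Sum>x\<in>weyl_supp a. weyl_scale (weyl_coeff a x) (weyl_monom x)) *
    (\<Sum>y\<in>weyl_supp b. weyl_scale (weyl_coeff b y) (weyl_monom y))"
    using weyl_sum_supp by metis
  then show ?thesis
    by (simp add: sum_product weyl_coeff_sum weyl_scale_mult_left weyl_scale_mult_right
        weyl_coeff_scale mult_ac)
qed

lemma weyl_coeff_commutator:
  "weyl_coeff (a * b - b * a) u = (\<Sum>x\<in>weyl_supp a. \<Sum>y\<in>weyl_supp b.
     weyl_coeff a x * weyl_coeff b y *
     weyl_coeff (weyl_monom x * weyl_monom y - weyl_monom y * weyl_monom x) u)"
  unfolding weyl_coeff_diff weyl_coeff_mult[of a b] weyl_coeff_mult[of b a]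
  by (subst (2) sum.swap) (simp add: right_diff_distrib sum_subtractf mult_ac)

section \<open>Products of monomials\<close>

text \<open>
  Each factor \<open>q\<close> either raises the exponent of \<open>q\<close> or removes one \<open>p\<close>, so only the points
  \<open>(k - m, j + l - m)\<close> with \<open>m \<le> j\<close> and \<open>m \<le> k\<close> occur. The coefficients for
  \<open>m = 0\<close> and \<open>m = 1\<close> decide the leading terms of products and of commutators.
\<close>

lemma weyl_coeff_q_power_times_monom_nonzero:
  assumes "weyl_coeff (weyl_q ^ j * weyl_monom (k, l)) (u, v) \<noteq> (0 :: 'a::field)"
  shows "u \<le> k \<and> k \<le> u + j \<and> v + k = j + l + u"
  using assms
proof (induction j arbitrary: u v)
  case (Suc j)
  then consider
      "v \<noteq> 0" "weyl_coeff (weyl_q ^ j * weyl_monom (k, l)) (u, v - 1) \<noteq> (0 :: 'a)"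
    | "weyl_coeff (weyl_q ^ j * weyl_monom (k, l)) (u + 1, v) \<noteq> (0 :: 'a)"
    by (fastforce simp: mult.assoc weyl_coeff_q_times split: if_splits)
  then show ?case
    by cases (use Suc.IH in fastforce)+
qed (simp add: weyl_coeff_monom split: if_splits)

lemma weyl_coeff_q_power_times_monom_top:
  "weyl_coeff (weyl_q ^ j * weyl_monom (k, l)) (k, j + l) = (1 :: 'a::field)"
proof (induction j)
  case (Suc j)
  have "weyl_coeff (weyl_q ^ j * weyl_monom (k, l) :: 'a weyl) (k + 1, Suc j + l) = 0"
    using weyl_coeff_q_power_times_monom_nonzero[of j k l "k + 1" "Suc j + l"] by force
  then show ?case using Suc by (simp add: mult.assoc weyl_coeff_q_times)
qed (simp add: weyl_coeff_monom)

lemma weyl_coeff_q_power_times_monom_second: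
  assumes "k \<ge> 1"
  shows "weyl_coeff (weyl_q ^ j * weyl_monom (k, l)) (k - 1, j + l - 1) = - (of_nat (j * k) :: 'a::field)"
proof (induction j)
  case 0
  then show ?case using assms by (simp add: weyl_coeff_monom)
next
  case (Suc j)
  have "weyl_coeff (weyl_q ^ j * weyl_monom (k, l)) (k, j + l) = (1 :: 'a)"
    by (rule weyl_coeff_q_power_times_monom_top)
  moreover have "j = 0" if "j + l = 0" using that by simp
  ultimately show ?case using Suc assms
    by (auto simp: mult.assoc weyl_coeff_q_times algebra_simps)
qed

lemma weyl_monom_mult:
  "weyl_monom (i, j) * b = weyl_p ^ i * (weyl_q ^ j * b)"
  by (simp add: weyl_monom_def mult.assoc)

lemma weyl_coeff_monom_mult_nonzero:
  assumes "weyl_coeff (weyl_monom (i, j) * weyl_monom (k, l)) (u, v) \<noteq> (0 :: 'a::field)"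
  shows "\<exists>m\<le>j. m \<le> k \<and> u + m = i + k \<and> v + m = j + l"
proof -
  have u: "i \<le> u" "weyl_coeff (weyl_q ^ j * weyl_monom (k, l)) (u - i, v) \<noteq> (0 :: 'a)"
    using assms by (auto simp: weyl_monom_mult weyl_coeff_p_power_times split: if_splits)
  from weyl_coeff_q_power_times_monom_nonzero[OF u(2)] u(1) show ?thesis
    by (intro exI[of _ "i + k - u"]) auto
qed

lemma weyl_coeff_monom_mult_top:
  "weyl_coeff (weyl_monom (i, j) * weyl_monom (k, l)) (i + k, j + l) = 1"
  by (simp add: weyl_monom_mult weyl_coeff_p_power_times weyl_coeff_q_power_times_monom_top)

lemma weyl_coeff_monom_mult_second:
  assumes "u + 1 = i + k" "v + 1 = j + l"
  shows "weyl_coeff (weyl_monom (i, j) * weyl_monom (k, l)) (u, v) = - of_nat (j * k)"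
proof (cases "k = 0")
  case True
  then have "u < i" using assms by simp
  then show ?thesis using True by (simp add: weyl_monom_mult weyl_coeff_p_power_times)
next
  case False
  then have "u - i = k - 1" "v = j + l - 1" "\<not> u < i" using assms by auto
  then show ?thesis using weyl_coeff_q_power_times_monom_second[of k j l] False
    by (simp add: weyl_monom_mult weyl_coeff_p_power_times)
qed

text \<open>
  The terms with \<open>m = 0\<close> in the two products have coefficient one and cancel.
\<close>

lemma weyl_coeff_monom_commutator_nonzero:
  assumes "weyl_coeff (weyl_monom (i, j) * weyl_monom (k, l) - weyl_monom (k, l) * weyl_monom (i, j))
    (u, v) \<noteq> (0 :: 'a::field)"
  shows "\<exists>m\<ge>1. (m \<le> j \<and> m \<le> k \<or> m \<le> l \<and> m \<le> i) \<and> u + m = i + k \<and> v + m = j + l"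
proof -
  have ne: "\<not> (u = i + k \<and> v = j + l)"
    using assms weyl_coeff_monom_mult_top[of i j k l, where 'a = 'a]
      weyl_coeff_monom_mult_top[of k l i j, where 'a = 'a]
    by (auto simp: weyl_coeff_diff add.commute)
  from assms consider
      "weyl_coeff (weyl_monom (i, j) * weyl_monom (k, l)) (u, v) \<noteq> (0 :: 'a)"
    | "weyl_coeff (weyl_monom (k, l) * weyl_monom (i, j)) (u, v) \<noteq> (0 :: 'a)"
    unfolding weyl_coeff_diff by fastforce
  then obtain m where "m \<le> j \<and> m \<le> k \<or> m \<le> l \<and> m \<le> i" "u + m = i + k" "v + m = j + l"
    by cases (use weyl_coeff_monom_mult_nonzero in \<open>fastforce simp: add.commute\<close>)+
  with ne show ?thesis by (intro exI[of _ m]) (cases m, auto)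
qed

lemma weyl_coeff_monom_commutator_top:
  assumes "u + 1 = i + k" "v + 1 = j + l"
  shows "weyl_coeff (weyl_monom (i, j) * weyl_monom (k, l) - weyl_monom (k, l) * weyl_monom (i, j))
    (u, v) = of_nat (i * l) - of_nat (j * k)"
proof -
  have "u + 1 = k + i" "v + 1 = l + j" using assms by auto
  then show ?thesis
    unfolding weyl_coeff_diff
    by (simp add: weyl_coeff_monom_mult_second assms mult.commute)
qed

lemma weyl_coeff_eqI:
  fixes a b :: "'k::field weyl"
  assumes "\<And>x. weyl_coeff a x = weyl_coeff b x"
  shows "a = b"
proof -
  have "weyl_coeff a = weyl_coeff b" using assms by (rule ext)
  then have "weyl_supp a = weyl_supp b" "weyl_coeff a = weyl_coeff b"
    by (simp_all add: weyl_supp_def)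
  then show ?thesis by (subst weyl_sum_supp, subst (3) weyl_sum_supp) (simp only:)
qed

lemma weyl_coeff_mult_nonzero:
  fixes a b :: "'k::field weyl"
  assumes "weyl_coeff (a * b) (u, v) \<noteq> 0"
  obtains i j k l m where "weyl_coeff a (i, j) \<noteq> 0" "weyl_coeff b (k, l) \<noteq> 0"
    "u + m = i + k" "v + m = j + l"
proof -
  obtain x where "(\<Sum>y\<in>weyl_supp b. weyl_coeff a x * weyl_coeff b y *
      weyl_coeff (weyl_monom x * weyl_monom y) (u, v)) \<noteq> 0"
    by (rule sum.not_neutral_contains_not_neutral[OF assms[unfolded weyl_coeff_mult[of a b]]])
  then obtain y where "weyl_coeff a x * weyl_coeff b y *
      weyl_coeff (weyl_monom x * weyl_monom y) (u, v) \<noteq> 0"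
    by (rule sum.not_neutral_contains_not_neutral)
  moreover obtain i j k l where "x = (i, j)" "y = (k, l)"
    by (metis surj_pair)
  ultimately have *: "weyl_coeff a (i, j) \<noteq> 0" "weyl_coeff b (k, l) \<noteq> 0"
    "weyl_coeff (weyl_monom (i, j) * weyl_monom (k, l)) (u, v) \<noteq> (0 :: 'k)"
    by simp_all
  from weyl_coeff_monom_mult_nonzero[OF *(3)] that[OF *(1,2)] show ?thesis by blast
qed

lemma weyl_coeff_commutator_nonzero:
  fixes a b :: "'k::field weyl"
  assumes "weyl_coeff (a * b - b * a) (u, v) \<noteq> 0"
  obtains i j k l m where "weyl_coeff a (i, j) \<noteq> 0" "weyl_coeff b (k, l) \<noteq> 0" "m \<ge> 1"
    "m \<le> j \<and> m \<le> k \<or> m \<le> l \<and> m \<le> i" "u + m = i + k" "v + m = j + l"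
proof -
  obtain x where "(\<Sum>y\<in>weyl_supp b. weyl_coeff a x * weyl_coeff b y *
      weyl_coeff (weyl_monom x * weyl_monom y - weyl_monom y * weyl_monom x) (u, v)) \<noteq> 0"
    by (rule sum.not_neutral_contains_not_neutral[OF assms[unfolded weyl_coeff_commutator[of a b]]])
  then obtain y where "weyl_coeff a x * weyl_coeff b y *
      weyl_coeff (weyl_monom x * weyl_monom y - weyl_monom y * weyl_monom x) (u, v) \<noteq> 0"
    by (rule sum.not_neutral_contains_not_neutral)
  moreover obtain i j k l where "x = (i, j)" "y = (k, l)"
    by (metis surj_pair)
  ultimately have *: "weyl_coeff a (i, j) \<noteq> 0" "weyl_coeff b (k, l) \<noteq> 0"
    "weyl_coeff (weyl_monom (i, j) * weyl_monom (k, l) - weyl_monom (k, l) * weyl_monom (i, j)) (u, v) \<noteq> (0 :: 'k)"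
    by simp_all
  from weyl_coeff_monom_commutator_nonzero[OF *(3)] that[OF *(1,2)] show ?thesis by blast
qed

text \<open>
  A constant term in \<open>p^i q^j p^k q^l\<close> needs \<open>i = l = 0\<close> and \<open>j = k\<close>, since all of the powers have to
  cancel. So pure powers \<open>q^m\<close> and \<open>p^m\<close> must meet.
\<close>

lemma commutator_constant_term:
  fixes a b :: "'k::field weyl"
  assumes "a * b - b * a = 1"
  obtains m where "m \<ge> 1"
    "weyl_coeff a (0, m) \<noteq> 0 \<and> weyl_coeff b (m, 0) \<noteq> 0 \<or>
     weyl_coeff a (m, 0) \<noteq> 0 \<and> weyl_coeff b (0, m) \<noteq> 0"
proof -
  have "weyl_coeff (a * b - b * a) (0, 0) \<noteq> 0"
    unfolding assms by (simp add: weyl_coeff_one)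
  then obtain i j k l m where *: "weyl_coeff a (i, j) \<noteq> 0" "weyl_coeff b (k, l) \<noteq> 0" "m \<ge> 1"
    "m \<le> j \<and> m \<le> k \<or> m \<le> l \<and> m \<le> i" "0 + m = i + k" "0 + m = j + l"
    by (rule weyl_coeff_commutator_nonzero)
  then have "i = 0 \<and> j = m \<and> k = m \<and> l = 0 \<or> i = m \<and> j = 0 \<and> k = 0 \<and> l = m"
    by linarith
  with * that show ?thesis by blast
qed

section \<open>Leading monomials\<close>

text \<open>
  Weight \<open>\<alpha> i + \<gamma> j\<close> first, then the exponent of \<open>p\<close>. For \<open>\<gamma> \<noteq> 0\<close> the leading monomial is unique. Along the
  diagonal \<open>(i - m, j - m)\<close>, on which correction terms lie, the weight drops by \<open>m (\<alpha> + \<gamma>)\<close>, which is why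
  \<open>\<alpha> + \<gamma> \<ge> 0\<close> appears in what follows; for \<open>\<alpha> + \<gamma> = 0\<close> it is the tie-break that makes corrections smaller.
\<close>

definition leading :: "int \<Rightarrow> int \<Rightarrow> 'k::field weyl \<Rightarrow> nat \<Rightarrow> nat \<Rightarrow> bool" where
  "leading \<alpha> \<gamma> a i j \<longleftrightarrow> weyl_coeff a (i, j) \<noteq> 0 \<and>
     (\<forall>i' j'. weyl_coeff a (i', j') \<noteq> 0 \<longrightarrow>
        \<alpha> * int i' + \<gamma> * int j' < \<alpha> * int i + \<gamma> * int j \<or>
        \<alpha> * int i' + \<gamma> * int j' = \<alpha> * int i + \<gamma> * int j \<and> i' \<le> i)"

lemma leading_nonzero: "leading \<alpha> \<gamma> a i j \<Longrightarrow> weyl_coeff a (i, j) \<noteq> 0"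
  by (simp add: leading_def)

lemma leading_weight_le:
  "leading \<alpha> \<gamma> a i j \<Longrightarrow> weyl_coeff a (i', j') \<noteq> 0 \<Longrightarrow>
    \<alpha> * int i' + \<gamma> * int j' \<le> \<alpha> * int i + \<gamma> * int j"
  by (force simp: leading_def)

lemma leading_tie:
  "leading \<alpha> \<gamma> a i j \<Longrightarrow> weyl_coeff a (i', j') \<noteq> 0 \<Longrightarrow>
    \<alpha> * int i' + \<gamma> * int j' = \<alpha> * int i + \<gamma> * int j \<Longrightarrow> i' \<le> i"
  by (force simp: leading_def)

lemma finite_argmax:
  fixes f :: "'a \<Rightarrow> 'b::linorder"
  assumes "finite A" "A \<noteq> {}"
  obtains x where "x \<in> A" "\<And>y. y \<in> A \<Longrightarrow> f y \<le> f x"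
proof -
  have "Max (f ` A) \<in> f ` A" using assms by simp
  then obtain x where "x \<in> A" "f x = Max (f ` A)" by force
  with assms that show ?thesis by (metis Max_ge finite_imageI imageI)
qed

lemma leading_exists:
  assumes "a \<noteq> 0"
  obtains i j where "leading \<alpha> \<gamma> a i j"
proof -
  define wt where "wt x = \<alpha> * int (fst x) + \<gamma> * int (snd x)" for x
  have "weyl_supp a \<noteq> {}"
    using weyl_sum_supp[of a] assms by (metis sum.empty)
  then obtain x where x: "x \<in> weyl_supp a" "\<And>y. y \<in> weyl_supp a \<Longrightarrow> wt y \<le> wt x"
    using finite_argmax[OF finite_weyl_supp, of a wt] by blast
  let ?B = "{y \<in> weyl_supp a. wt y = wt x}"
  have "x \<in> ?B" using x(1) by simp
  then have "finite ?B" "?B \<noteq> {}" using finite_weyl_supp[of a] by (simp, blast)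
  then obtain y where y: "y \<in> ?B" "\<And>y'. y' \<in> ?B \<Longrightarrow> fst y' \<le> fst y"
    using finite_argmax[of ?B fst] by blast
  have "leading \<alpha> \<gamma> a (fst y) (snd y)"
    unfolding leading_def
  proof (intro conjI allI impI)
    show "weyl_coeff a (fst y, snd y) \<noteq> 0" using y(1) by (simp add: weyl_supp_def)
  next
    fix i' j' assume "weyl_coeff a (i', j') \<noteq> 0"
    then have s: "(i', j') \<in> weyl_supp a" by (simp add: weyl_supp_def)
    show "\<alpha> * int i' + \<gamma> * int j' < \<alpha> * int (fst y) + \<gamma> * int (snd y) \<or>
        \<alpha> * int i' + \<gamma> * int j' = \<alpha> * int (fst y) + \<gamma> * int (snd y) \<and> i' \<le> fst y"
      using x(2)[OF s] y(2)[of "(i', j')"] y(1) s by (auto simp: wt_def)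
  qed
  with that show ?thesis .
qed

text \<open>
  The weight of a term of a product is bounded by the sum of the leading weights. In the case of equality
  both factors have maximal weight, so that the tie-break applies to each of them.
\<close>

lemma leading_pair_weight:
  assumes "leading \<alpha> \<gamma> a i j" "leading \<alpha> \<gamma> b k l" "\<alpha> + \<gamma> \<ge> 0"
    and "weyl_coeff a (i', j') \<noteq> 0" "weyl_coeff b (k', l') \<noteq> 0"
    and "u + m = i' + k'" "v + m = j' + l'"
  shows "\<alpha> * int u + \<gamma> * int v \<le> \<alpha> * int (i + k) + \<gamma> * int (j + l)"
    and "\<alpha> * int u + \<gamma> * int v = \<alpha> * int (i + k) + \<gamma> * int (j + l) \<Longrightarrow> i' \<le> i \<and> k' \<le> k \<and>
      \<alpha> * int i' + \<gamma> * int j' = \<alpha> * int i + \<gamma> * int j \<and>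
      \<alpha> * int k' + \<gamma> * int l' = \<alpha> * int k + \<gamma> * int l"
proof -
  have uv: "int u = int i' + int k' - int m" "int v = int j' + int l' - int m"
    using assms(6,7) by linarith+
  have e: "\<alpha> * int u + \<gamma> * int v + int m * (\<alpha> + \<gamma>) =
      (\<alpha> * int i' + \<gamma> * int j') + (\<alpha> * int k' + \<gamma> * int l')"
    unfolding uv by (simp add: algebra_simps)
  have f: "\<alpha> * int (i + k) + \<gamma> * int (j + l) =
      (\<alpha> * int i + \<gamma> * int j) + (\<alpha> * int k + \<gamma> * int l)"
    by (simp add: algebra_simps)
  have g: "int m * (\<alpha> + \<gamma>) \<ge> 0" using assms(3) by simp
  note le = leading_weight_le[OF assms(1,4)] leading_weight_le[OF assms(2,5)]
  from e f g le show "\<alpha> * int u + \<gamma> * int v \<le> \<alpha> * int (i + k) + \<gamma> * int (j + l)"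
    by linarith
  assume "\<alpha> * int u + \<gamma> * int v = \<alpha> * int (i + k) + \<gamma> * int (j + l)"
  with e f g le have *: "\<alpha> * int i' + \<gamma> * int j' = \<alpha> * int i + \<gamma> * int j"
      "\<alpha> * int k' + \<gamma> * int l' = \<alpha> * int k + \<gamma> * int l"
    by linarith+
  with leading_tie[OF assms(1,4)] leading_tie[OF assms(2,5)]
  show "i' \<le> i \<and> k' \<le> k \<and> \<alpha> * int i' + \<gamma> * int j' = \<alpha> * int i + \<gamma> * int j \<and>
      \<alpha> * int k' + \<gamma> * int l' = \<alpha> * int k + \<gamma> * int l"
    by blast
qed

text \<open>
  At the sum of the leading points or beyond it on the diagonal, the only contribution comes from the two
  leading monomials.
\<close>

lemma leading_pair_unique:
  assumes "leading \<alpha> \<gamma> a i j" "leading \<alpha> \<gamma> b k l" "\<alpha> + \<gamma> \<ge> 0" "\<gamma> \<noteq> 0"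
    and "weyl_coeff a (i', j') \<noteq> 0" "weyl_coeff b (k', l') \<noteq> 0"
    and "i + k + m = i' + k'" "j + l + m = j' + l'"
  shows "i' = i \<and> j' = j \<and> k' = k \<and> l' = l"
proof -
  have *: "i' \<le> i" "k' \<le> k" "\<alpha> * int i' + \<gamma> * int j' = \<alpha> * int i + \<gamma> * int j"
      "\<alpha> * int k' + \<gamma> * int l' = \<alpha> * int k + \<gamma> * int l"
    using leading_pair_weight(2)[OF assms(1-3,5-8)] by auto
  then have "i' = i" "k' = k" using assms(7) by linarith+
  with * assms(4) show ?thesis by simp
qed

lemma double_sum_single:
  assumes "finite A" "finite B" "x0 \<in> A" "y0 \<in> B"
    and "\<And>x y. x \<in> A \<Longrightarrow> y \<in> B \<Longrightarrow> f x y \<noteq> 0 \<Longrightarrow> x = x0 \<and> y = y0"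
  shows "(\<Sum>x\<in>A. \<Sum>y\<in>B. f x y) = f x0 y0"
proof -
  have "(\<Sum>x\<in>A. \<Sum>y\<in>B. f x y) = (\<Sum>y\<in>B. f x0 y)"
  proof -
    have "(\<Sum>x\<in>A - {x0}. \<Sum>y\<in>B. f x y) = 0"
      using assms(5) by (intro sum.neutral ballI) (metis Diff_iff singletonI)
    then show ?thesis using sum.remove[OF assms(1,3)] by (metis add.right_neutral)
  qed
  also have "\<dots> = f x0 y0"
  proof -
    have "(\<Sum>y\<in>B - {y0}. f x0 y) = 0"
      using assms(3,5) by (intro sum.neutral ballI) (metis Diff_iff singletonI)
    then show ?thesis using sum.remove[OF assms(2,4)] by (metis add.right_neutral)
  qed
  finally show ?thesis .
qed

lemma leading_coeff_mult:
  fixes a b :: "'k::field weyl"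
  assumes "leading \<alpha> \<gamma> a i j" "leading \<alpha> \<gamma> b k l" "\<alpha> + \<gamma> \<ge> 0" "\<gamma> \<noteq> 0"
  shows "weyl_coeff (a * b) (i + k, j + l) = weyl_coeff a (i, j) * weyl_coeff b (k, l)"
proof -
  have "weyl_coeff (a * b) (i + k, j + l) = weyl_coeff a (i, j) * weyl_coeff b (k, l) *
      weyl_coeff (weyl_monom (i, j) * weyl_monom (k, l)) (i + k, j + l)"
    unfolding weyl_coeff_mult[of a b]
  proof (rule double_sum_single)
    fix x y
    assume xy: "x \<in> weyl_supp a" "y \<in> weyl_supp b" and "weyl_coeff a x * weyl_coeff b y *
      weyl_coeff (weyl_monom x * weyl_monom y) (i + k, j + l) \<noteq> 0"
    then have "weyl_coeff (weyl_monom (fst x, snd x) * weyl_monom (fst y, snd y)) (i + k, j + l)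
        \<noteq> (0 :: 'k)" by simp
    from weyl_coeff_monom_mult_nonzero[OF this] obtain m where
      m: "i + k + m = fst x + fst y" "j + l + m = snd x + snd y" by blast
    from xy have "weyl_coeff a (fst x, snd x) \<noteq> 0" "weyl_coeff b (fst y, snd y) \<noteq> 0"
      by (simp_all add: weyl_supp_def)
    from leading_pair_unique[OF assms this m] show "x = (i, j) \<and> y = (k, l)"
      by (metis prod.collapse)
  qed (simp_all add: finite_weyl_supp mem_weyl_supp leading_nonzero[OF assms(1)]
      leading_nonzero[OF assms(2)])
  then show ?thesis unfolding weyl_coeff_monom_mult_top by simp
qed

lemma leading_coeff_commutator:
  fixes a b :: "'k::field weyl"
  assumes "leading \<alpha> \<gamma> a i j" "leading \<alpha> \<gamma> b k l" "\<alpha> + \<gamma> \<ge> 0" "\<gamma> \<noteq> 0"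
    and uv: "u + 1 = i + k" "v + 1 = j + l"
  shows "weyl_coeff (a * b - b * a) (u, v) =
    weyl_coeff a (i, j) * weyl_coeff b (k, l) * (of_nat (i * l) - of_nat (j * k))"
proof -
  have "weyl_coeff (a * b - b * a) (u, v) = weyl_coeff a (i, j) * weyl_coeff b (k, l) *
      weyl_coeff (weyl_monom (i, j) * weyl_monom (k, l) - weyl_monom (k, l) * weyl_monom (i, j))
        (u, v)"
    unfolding weyl_coeff_commutator[of a b]
  proof (rule double_sum_single)
    fix x y
    assume xy: "x \<in> weyl_supp a" "y \<in> weyl_supp b" and "weyl_coeff a x * weyl_coeff b y *
      weyl_coeff (weyl_monom x * weyl_monom y - weyl_monom y * weyl_monom x) (u, v) \<noteq> 0"
    then have "weyl_coeff (weyl_monom (fst x, snd x) * weyl_monom (fst y, snd y) -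
        weyl_monom (fst y, snd y) * weyl_monom (fst x, snd x)) (u, v) \<noteq> (0 :: 'k)" by simp
    from weyl_coeff_monom_commutator_nonzero[OF this] obtain m where
      "m \<ge> 1" "u + m = fst x + fst y" "v + m = snd x + snd y" by blast
    then have m: "i + k + (m - 1) = fst x + fst y" "j + l + (m - 1) = snd x + snd y"
      using uv by linarith+
    from xy have "weyl_coeff a (fst x, snd x) \<noteq> 0" "weyl_coeff b (fst y, snd y) \<noteq> 0"
      by (simp_all add: weyl_supp_def)
    from leading_pair_unique[OF assms(1-4) this m] show "x = (i, j) \<and> y = (k, l)"
      by (metis prod.collapse)
  qed (simp_all add: finite_weyl_supp mem_weyl_supp leading_nonzero[OF assms(1)]
      leading_nonzero[OF assms(2)])
  then show ?thesis by (simp add: weyl_coeff_monom_commutator_top[OF uv])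
qed

lemma leading_mult:
  fixes a b :: "'k::field weyl"
  assumes "leading \<alpha> \<gamma> a i j" "leading \<alpha> \<gamma> b k l" "\<alpha> + \<gamma> \<ge> 0" "\<gamma> \<noteq> 0"
  shows "leading \<alpha> \<gamma> (a * b) (i + k) (j + l)"
  unfolding leading_def
proof (intro conjI allI impI)
  show "weyl_coeff (a * b) (i + k, j + l) \<noteq> 0"
    using leading_coeff_mult[OF assms] assms(1,2) by (simp add: leading_nonzero)
next
  fix u v
  assume "weyl_coeff (a * b) (u, v) \<noteq> 0"
  then obtain i' j' k' l' m where *: "weyl_coeff a (i', j') \<noteq> 0" "weyl_coeff b (k', l') \<noteq> 0"
    "u + m = i' + k'" "v + m = j' + l'"
    by (rule weyl_coeff_mult_nonzero)
  from leading_pair_weight[OF assms(1-3) *] *(3)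
  show "\<alpha> * int u + \<gamma> * int v < \<alpha> * int (i + k) + \<gamma> * int (j + l) \<or>
      \<alpha> * int u + \<gamma> * int v = \<alpha> * int (i + k) + \<gamma> * int (j + l) \<and> u \<le> i + k"
    by linarith
qed

lemma leading_power:
  assumes "leading \<alpha> \<gamma> a i j" "\<alpha> + \<gamma> \<ge> 0" "\<gamma> \<noteq> 0"
  shows "leading \<alpha> \<gamma> (a ^ n) (n * i) (n * j)"
proof (induction n)
  case 0
  then show ?case by (simp add: leading_def weyl_coeff_one)
next
  case (Suc n)
  from leading_mult[OF assms(1) this assms(2,3)] show ?case by simp
qed

text \<open>
  If \<open>il \<noteq> jk\<close>, then the point \<open>(i + k - 1, j + l - 1)\<close> carries the nonzero coefficient
  \<open>(il - jk)\<close> times the leading coefficients, and \<open>1\<close> has support \<open>(0, 0)\<close>. Characteristic zero enters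
  here, to keep \<open>il - jk\<close> nonzero in the field.
\<close>

lemma leading_commutator_one:
  fixes a b :: "'k::field_char_0 weyl"
  assumes "a * b - b * a = 1" "leading \<alpha> \<gamma> a i j" "leading \<alpha> \<gamma> b k l" "\<alpha> + \<gamma> \<ge> 0" "\<gamma> \<noteq> 0"
  shows "i * l = j * k \<or> i + k = 1 \<and> j + l = 1"
proof (rule ccontr)
  assume neg: "\<not> ?thesis"
  then have "i + k \<ge> 1" "j + l \<ge> 1" by (auto simp: Suc_le_eq)
  then obtain u v where uv: "u + 1 = i + k" "v + 1 = j + l"
    by (metis le_add_diff_inverse2)
  have "(of_nat (i * l) :: 'k) \<noteq> of_nat (j * k)"
    using neg of_nat_eq_iff by blast
  then have "weyl_coeff (a * b - b * a) (u, v) \<noteq> 0"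
    unfolding leading_coeff_commutator[OF assms(2-5) uv]
    using assms(2,3) leading_nonzero by fastforce
  then have "u = 0 \<and> v = 0" unfolding assms(1) by (simp add: weyl_coeff_one split: if_splits)
  with uv neg show False by simp
qed

section \<open>Generation from a pair bounded in degree\<close>

lemma weyl_subalgebra_scale: "weyl_subalgebra S \<Longrightarrow> a \<in> S \<Longrightarrow> weyl_scale c a \<in> S"
  by (simp add: weyl_subalgebra_def weyl.subspace_scale)

lemma weyl_subalgebra_diff: "weyl_subalgebra S \<Longrightarrow> a \<in> S \<Longrightarrow> b \<in> S \<Longrightarrow> a - b \<in> S"
  by (simp add: weyl_subalgebra_def weyl.subspace_diff)

lemma weyl_subalgebra_power: "weyl_subalgebra S \<Longrightarrow> a \<in> S \<Longrightarrow> a ^ n \<in> S"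
  by (induction n) (simp_all add: weyl_subalgebra_def)

text \<open>
  The rotation of the weight. For a weight \<open>(a, -b)\<close>, a monomial \<open>p^i q^j\<close> of \<open>P\<close> ties with \<open>p\<close> when
  \<open>(i - 1) / j = b / a\<close>, and one of \<open>Q\<close> ties with \<open>q\<close> when \<open>i / (j - 1) = b / a\<close>. If the conclusion failed,
  the largest of these slopes would be positive, and at most one by the bounds on degrees. With \<open>b / a\<close> equal to it,
  the leading weights are those of \<open>p\<close> and \<open>q\<close>, but a tie is attained by a larger exponent of \<open>p\<close>, which
  contradicts \<open>leading_commutator_one\<close>.
\<close>

lemma commutator_one_p_degree:
  fixes P Q :: "'k::field_char_0 weyl"
  assumes comm: "P * Q - Q * P = 1"
    and P: "\<And>i j. weyl_coeff P (i, j) \<noteq> 0 \<Longrightarrow> i \<le> j + 1"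
    and Q: "\<And>i j. weyl_coeff Q (i, j) \<noteq> 0 \<Longrightarrow> i + 1 \<le> j"
    and P10: "weyl_coeff P (1, 0) \<noteq> 0" and Q01: "weyl_coeff Q (0, 1) \<noteq> 0"
  shows "(\<forall>i j. weyl_coeff P (i, j) \<noteq> 0 \<longrightarrow> i \<le> 1) \<and>
    (\<forall>i j. weyl_coeff Q (i, j) \<noteq> 0 \<longrightarrow> i = 0)"
proof (rule ccontr)
  assume neg: "\<not> ?thesis"
  \<comment> \<open>Monomials that can tie with \<open>p\<close> or \<open>q\<close>, translated so that the slope is \<open>x / y\<close>.\<close>
  define T where "T = {(x, y). x \<ge> 1 \<and>
    (weyl_coeff P (x + 1, y) \<noteq> 0 \<or> weyl_coeff Q (x, y + 1) \<noteq> 0)}"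
  have sub: "T \<subseteq> (\<lambda>(i, j). (i - 1, j)) ` weyl_supp P \<union> (\<lambda>(i, j). (i, j - 1)) ` weyl_supp Q"
  proof
    fix t assume "t \<in> T"
    then obtain x y where t: "t = (x, y)"
      "weyl_coeff P (x + 1, y) \<noteq> 0 \<or> weyl_coeff Q (x, y + 1) \<noteq> 0" by (auto simp: T_def)
    then consider "(x + 1, y) \<in> weyl_supp P" | "(x, y + 1) \<in> weyl_supp Q"
      by (auto simp: mem_weyl_supp)
    then show "t \<in> (\<lambda>(i, j). (i - 1, j)) ` weyl_supp P \<union> (\<lambda>(i, j). (i, j - 1)) ` weyl_supp Q"
      by cases (force simp: t(1))+
  qed
  have "finite T"
    by (rule finite_subset[OF sub]) (simp add: finite_weyl_supp)
  moreover have "T \<noteq> {}"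
  proof -
    from neg consider i j where "weyl_coeff P (i, j) \<noteq> 0" "i > 1"
      | i j where "weyl_coeff Q (i, j) \<noteq> 0" "i \<noteq> 0" by (auto simp: not_le)
    then show ?thesis
    proof cases
      case (1 i j)
      then have "(i - 1, j) \<in> T" by (simp add: T_def)
      then show ?thesis by blast
    next
      case (2 i j)
      then have "(i, j - 1) \<in> T" using Q[of i j] by (simp add: T_def)
      then show ?thesis by blast
    qed
  qed
  ultimately obtain t where t: "t \<in> T"
    "\<And>s. s \<in> T \<Longrightarrow> real (fst s) / real (snd s) \<le> real (fst t) / real (snd t)"
    using finite_argmax[of T "\<lambda>s. real (fst s) / real (snd s)"] by blast
  obtain b a where ba: "t = (b, a)" by (metis surj_pair)
  have pos: "x \<ge> 1 \<and> y \<ge> x" if "(x, y) \<in> T" for x y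
    using that P[of "x + 1" y] Q[of x "y + 1"] by (auto simp: T_def)
  have b: "b \<ge> 1" and ab: "a \<ge> b" using pos[of b a] t(1) ba by auto
  have slope: "int a * int x \<le> int b * int y" if "(x, y) \<in> T" for x y
  proof -
    have "real x / real y \<le> real b / real a" using t(2)[OF that] ba by simp
    moreover have "real y > 0" "real a > 0" using pos[OF that] b ab by auto
    ultimately have "real a * real x \<le> real b * real y" by (simp add: field_simps)
    then show ?thesis by (metis of_nat_le_iff of_nat_mult)
  qed
  let ?wt = "\<lambda>i j. int a * int i + (- int b) * int j"
  have wP: "?wt i j \<le> int a" if "weyl_coeff P (i, j) \<noteq> 0" for i j
  proof (cases "i \<le> 1")
    case True
    then have "int a * int i \<le> int a * 1" by (intro mult_left_mono) auto
    moreover have "int b * int j \<ge> 0" by simp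
    ultimately show ?thesis by linarith
  next
    case False
    then have "(i - 1, j) \<in> T" using that by (simp add: T_def)
    from slope[OF this] False show ?thesis by (simp add: of_nat_diff algebra_simps)
  qed
  have wQ: "?wt i j \<le> - int b" if "weyl_coeff Q (i, j) \<noteq> 0" for i j
  proof (cases "i = 0")
    case True
    then have "int b * int j \<ge> int b * 1" using Q[OF that] by (intro mult_left_mono) auto
    then show ?thesis using True by simp
  next
    case False
    then have "(i, j - 1) \<in> T" using that Q[OF that] by (simp add: T_def)
    from slope[OF this] Q[OF that] show ?thesis by (simp add: of_nat_diff algebra_simps)
  qed
  have "P \<noteq> 0" "Q \<noteq> 0" using P10 Q01 by auto
  then obtain i j k l where lP: "leading (int a) (- int b) P i j"
    and lQ: "leading (int a) (- int b) Q k l"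
    using leading_exists by metis
  have "?wt i j = int a"
    using leading_weight_le[OF lP P10] by (intro antisym wP[OF leading_nonzero[OF lP]]) simp
  then have eP: "int a * int i = int a + int b * int j" by linarith
  have "?wt k l = - int b"
    using leading_weight_le[OF lQ Q01] by (intro antisym wQ[OF leading_nonzero[OF lQ]]) simp
  then have eQ: "int b * int l = int b + int a * int k" by linarith
  \<comment> \<open>On the two critical lines, \<open>ab (il - jk) = ab + a^2 k + b^2 j > 0\<close>.\<close>
  have "i * l \<noteq> j * k"
  proof
    assume "i * l = j * k"
    then have "int i * int l = int j * int k" by (metis of_nat_mult)
    then have "(int a * int i) * (int b * int l) = int a * int b * (int j * int k)"
      by (simp add: mult_ac)
    then have "int a * int b + int a * int a * int k + int b * int b * int j = 0"
      unfolding eP eQ by (simp add: algebra_simps)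
    moreover have "int a * int b > 0" using b ab by simp
    moreover have "int a * int a * int k \<ge> 0" "int b * int b * int j \<ge> 0" by simp_all
    ultimately show False by linarith
  qed
  with leading_commutator_one[OF comm lP lQ] b ab have ijkl: "i + k = 1" "j + l = 1" by auto
  have "i \<noteq> 0"
  proof
    assume "i = 0"
    then have "int a + int b * int j = 0" using eP by simp
    moreover have "int b * int j \<ge> 0" by simp
    ultimately show False using b ab by linarith
  qed
  with ijkl have ik: "i = 1" "k = 0" by auto
  \<comment> \<open>The monomial that defines the slope ties with the leading one and has a larger exponent of \<open>p\<close>.\<close>
  from t(1) ba consider "weyl_coeff P (b + 1, a) \<noteq> 0" | "weyl_coeff Q (b, a + 1) \<noteq> 0"
    by (auto simp: T_def)
  then show False
  proof cases
    case 1
    from leading_tie[OF lP 1] \<open>?wt i j = int a\<close> have "b + 1 \<le> i"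
      by (simp add: algebra_simps)
    with ik b show False by simp
  next
    case 2
    from leading_tie[OF lQ 2] \<open>?wt k l = - int b\<close> have "b \<le> k"
      by (simp add: algebra_simps)
    with ik b show False by simp
  qed
qed

text \<open>
  Once the exponents of \<open>p\<close> are bounded, \<open>[p g(q) + f(q), h(q)] = g(q) h'(q)\<close> can only be \<open>1\<close> for constant
  \<open>g\<close> and linear \<open>h\<close>.
\<close>

lemma commutator_one_triangular:
  fixes P Q :: "'k::field_char_0 weyl"
  assumes comm: "P * Q - Q * P = 1"
    and P: "\<And>i j. weyl_coeff P (i, j) \<noteq> 0 \<Longrightarrow> i \<le> j + 1"
    and Q: "\<And>i j. weyl_coeff Q (i, j) \<noteq> 0 \<Longrightarrow> i + 1 \<le> j"
  shows "weyl_coeff P (1, 0) \<noteq> 0 \<and> weyl_coeff Q (0, 1) \<noteq> 0 \<and>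
    (\<forall>i j. weyl_coeff P (i, j) \<noteq> 0 \<longrightarrow> i = 0 \<or> i = 1 \<and> j = 0) \<and>
    (\<forall>i j. weyl_coeff Q (i, j) \<noteq> 0 \<longrightarrow> i = 0 \<and> j = 1)"
proof -
  obtain m where "m \<ge> 1"
    "weyl_coeff P (0, m) \<noteq> 0 \<and> weyl_coeff Q (m, 0) \<noteq> 0 \<or>
     weyl_coeff P (m, 0) \<noteq> 0 \<and> weyl_coeff Q (0, m) \<noteq> 0"
    using commutator_constant_term[OF comm] by blast
  with P[of m 0] Q[of m 0] have "m = 1" "weyl_coeff P (m, 0) \<noteq> 0" "weyl_coeff Q (0, m) \<noteq> 0"
    by auto
  then have P10: "weyl_coeff P (1, 0) \<noteq> 0" and Q01: "weyl_coeff Q (0, 1) \<noteq> 0" by auto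
  have Pi: "i \<le> 1" if "weyl_coeff P (i, j) \<noteq> 0" for i j
    using commutator_one_p_degree[OF comm P Q P10 Q01] that by blast
  have Qi: "i = 0" if "weyl_coeff Q (i, j) \<noteq> 0" for i j
    using commutator_one_p_degree[OF comm P Q P10 Q01] that by blast
  \<comment> \<open>With \<open>N\<close> above the degree of \<open>P\<close> in \<open>q\<close>, the weight \<open>(N, 1)\<close> ranks every \<open>p q^j\<close> in \<open>P\<close> above all
      powers of \<open>q\<close>. Then \<open>P\<close> leads with some \<open>p q^j\<close> and \<open>Q\<close> with some \<open>q^l\<close>, \<open>l > 0\<close>, so \<open>il > jk\<close>.\<close>
  define N where "N = Suc (Max (snd ` weyl_supp P))"
  have N: "j < N" if "weyl_coeff P (i, j) \<noteq> 0" for i j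
  proof -
    have "j \<in> snd ` weyl_supp P" using that by (force simp: mem_weyl_supp)
    then show ?thesis unfolding N_def by (simp add: finite_weyl_supp less_Suc_eq_le)
  qed
  have "P \<noteq> 0" "Q \<noteq> 0" using P10 Q01 by auto
  then obtain i j k l where lP: "leading (int N) 1 P i j" and lQ: "leading (int N) 1 Q k l"
    using leading_exists by metis
  have "i = 1"
  proof (rule ccontr)
    assume "i \<noteq> 1"
    with Pi[OF leading_nonzero[OF lP]] have "i = 0" by simp
    with leading_weight_le[OF lP P10] N[OF leading_nonzero[OF lP]] show False by simp
  qed
  moreover have "k = 0" using Qi[OF leading_nonzero[OF lQ]] .
  moreover from this have "l \<ge> 1" using leading_weight_le[OF lQ Q01] by simp
  moreover note leading_commutator_one[OF comm lP lQ]
  ultimately have jl: "i = 1" "k = 0" "j = 0" "l = 1" by auto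
  have "j' = 0" if "weyl_coeff P (1, j') \<noteq> 0" for j'
    using leading_weight_le[OF lP that] jl by simp
  moreover have "j' = 1" if "weyl_coeff Q (0, j') \<noteq> 0" for j'
    using leading_weight_le[OF lQ that] Q[OF that] jl by simp
  ultimately show ?thesis
    using P10 Q01 Pi Qi by (metis le_Suc_eq One_nat_def le_zero_eq)
qed

lemma commutator_one_generates_triangular:
  fixes P Q :: "'k::field_char_0 weyl"
  assumes S: "weyl_subalgebra S" and mem: "P \<in> S" "Q \<in> S"
    and comm: "P * Q - Q * P = 1"
    and P: "\<And>i j. weyl_coeff P (i, j) \<noteq> 0 \<Longrightarrow> i \<le> j + 1"
    and Q: "\<And>i j. weyl_coeff Q (i, j) \<noteq> 0 \<Longrightarrow> i + 1 \<le> j"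
  shows "S = UNIV"
proof -
  note tri = commutator_one_triangular[OF comm P Q]
  have monom: "weyl_monom (0, j) = (weyl_q ^ j :: 'k weyl)" "weyl_monom (1, 0) = (weyl_p :: 'k weyl)"
    for j
    by (simp_all add: weyl_monom_def)
  have "Q = weyl_scale (weyl_coeff Q (0, 1)) (weyl_monom (0, 1))"
  proof (rule weyl_coeff_eqI)
    fix x show "weyl_coeff Q x = weyl_coeff (weyl_scale (weyl_coeff Q (0, 1)) (weyl_monom (0, 1))) x"
      using tri by (cases x) (auto simp: weyl_coeff_scale weyl_coeff_monom)
  qed
  then have "weyl_q = weyl_scale (inverse (weyl_coeff Q (0, 1))) Q"
    using tri monom(1)[of 1] by (metis left_inverse power_one_right weyl.scale_scale weyl.scale_one)
  then have q: "weyl_q \<in> S" using weyl_subalgebra_scale[OF S mem(2)] by metis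
  let ?R = "P - weyl_scale (weyl_coeff P (1, 0)) weyl_p"
  have coeff: "weyl_coeff ?R x = (if x = (1, 0) then 0 else weyl_coeff P x)" for x
    unfolding monom(2)[symmetric] weyl_coeff_diff weyl_coeff_scale weyl_coeff_monom by simp
  have "weyl_monom x \<in> S" if "x \<in> weyl_supp ?R" for x
  proof -
    obtain i j where x: "x = (i, j)" by (cases x)
    with that have "(i, j) \<noteq> (1, 0)" "weyl_coeff P (i, j) \<noteq> 0"
      unfolding mem_weyl_supp coeff by (metis (full_types))+
    with tri have "i = 0" by blast
    then show ?thesis
      by (simp add: x monom(1) weyl_subalgebra_power[OF S q])
  qed
  then have "(\<Sum>x\<in>weyl_supp ?R. weyl_scale (weyl_coeff ?R x) (weyl_monom x)) \<in> S"
    using S weyl_subalgebra_scale[OF S]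
    by (intro weyl.subspace_sum) (auto simp: weyl_subalgebra_def)
  then have "?R \<in> S" by (simp only: weyl_sum_supp[symmetric])
  then have "weyl_scale (weyl_coeff P (1, 0)) weyl_p \<in> S"
    using weyl_subalgebra_diff[OF S mem(1)] by (metis diff_diff_eq2 add_diff_cancel_left')
  then have "weyl_scale (inverse (weyl_coeff P (1, 0))) (weyl_scale (weyl_coeff P (1, 0)) weyl_p) \<in> S"
    by (rule weyl_subalgebra_scale[OF S])
  then have "weyl_p \<in> S" using tri by simp
  then show ?thesis using subalgebra_generated_by_p_q[OF S _ q] by simp
qed

section \<open>Reduction to a bounded pair\<close>

text \<open>
  The leading monomials for the weight \<open>(1, -1)\<close> are those of lowest degree. If \<open>(i + 1) l = i k\<close>, then
  \<open>(k, l)\<close> is \<open>n (i + 1, i)\<close> with \<open>n = k - l\<close>, the leading monomial of \<open>z^n\<close>, and subtracting a multiple of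
  \<open>z^n\<close> from \<open>w\<close> either raises the lowest degree of \<open>w\<close> or keeps it and lowers \<open>k\<close>. In the other case of
  \<open>leading_commutator_one\<close>, \<open>w\<close> leads with \<open>q\<close> and the pair \<open>z, w\<close> is bounded as required.
\<close>

lemma generates_of_degree_minus_one_part:
  fixes z w :: "'k::field_char_0 weyl"
  assumes S: "weyl_subalgebra S" and zS: "z \<in> S"
    and z: "\<And>i j. weyl_coeff z (i, j) \<noteq> 0 \<Longrightarrow> i \<le> j + 1"
    and lz: "leading 1 (- 1) z (i + 1) i"
    and w: "w \<in> S" "z * w - w * z = 1" "leading 1 (- 1) w k l"
  shows "S = UNIV"
  using w
proof (induction "(k + 1 - l, k)" arbitrary: w k l
    rule: wf_induct_rule[OF wf_lex_prod[OF wf_less_than wf_less_than]])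
  case (1 k l w)
  consider (minimal) "i = 0" "k = 0" "l = 1" | (reduce) "(i + 1) * l = i * k"
    using leading_commutator_one[OF "1.prems"(2) lz "1.prems"(3)] by force
  then show ?case
  proof cases
    case minimal
    have "i' + 1 \<le> j'" if "weyl_coeff w (i', j') \<noteq> 0" for i' j'
      using leading_weight_le[OF "1.prems"(3) that] minimal by simp
    with z show ?thesis
      using commutator_one_generates_triangular[OF S zS "1.prems"(1,2)] by blast
  next
    case reduce
    have kl: "l \<le> k"
    proof (rule ccontr)
      assume "\<not> l \<le> k"
      then have "i * k \<le> i * l" "l > 0" by auto
      with reduce show False by simp
    qed
    define n where "n = k - l"
    have k: "k = l + n" using kl by (simp add: n_def)
    have l': "l = n * i" using reduce by (simp add: k algebra_simps)
    have k': "k = n * (i + 1)" by (simp add: k l')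
    have lzn: "leading 1 (- 1) (z ^ n) k l"
      using leading_power[OF lz, of n] k' l' by simp
    define c where "c = weyl_coeff w (k, l) / weyl_coeff (z ^ n) (k, l)"
    define w' where "w' = w - weyl_scale c (z ^ n)"
    have comm: "z * w' - w' * z = 1"
      using "1.prems"(2)
      by (simp add: w'_def right_diff_distrib left_diff_distrib weyl_scale_mult_left
          weyl_scale_mult_right power_commutes)
    then have "w' \<noteq> 0" by auto
    then obtain k1 l1 where lw': "leading 1 (- 1) w' k1 l1" by (rule leading_exists)
    have w'S: "w' \<in> S"
      unfolding w'_def
      by (intro weyl_subalgebra_diff[OF S] weyl_subalgebra_scale[OF S] weyl_subalgebra_power[OF S]
          zS "1.prems")
    have coeff: "weyl_coeff w' x = weyl_coeff w x - c * weyl_coeff (z ^ n) x" for x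
      by (simp add: w'_def weyl_coeff_diff weyl_coeff_scale)
    have "weyl_coeff w' (k, l) = 0"
      unfolding coeff c_def using leading_nonzero[OF lzn] by simp
    then have ne: "(k1, l1) \<noteq> (k, l)" using leading_nonzero[OF lw'] by metis
    have "weyl_coeff w (k1, l1) \<noteq> 0 \<or> weyl_coeff (z ^ n) (k1, l1) \<noteq> 0"
      using leading_nonzero[OF lw'] unfolding coeff by auto
    moreover have "int k1 - int l1 < int k - int l \<or> int k1 - int l1 = int k - int l \<and> k1 \<le> k"
      if "leading 1 (- 1) a k l" "weyl_coeff a (k1, l1) \<noteq> 0" for a :: "'k weyl"
      using leading_weight_le[OF that] leading_tie[OF that] by auto
    ultimately have
      "int k1 - int l1 < int k - int l \<or> int k1 - int l1 = int k - int l \<and> k1 \<le> k"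
      using "1.prems"(3) lzn by blast
    then have "int k1 - int l1 < int k - int l \<or> int k1 - int l1 = int k - int l \<and> k1 < k"
      using ne by auto
    then have "((k1 + 1 - l1, k1), (k + 1 - l, k)) \<in> less_than <*lex*> less_than"
      using kl by auto
    then show ?thesis
      using w'S comm lw' by (rule "1.hyps")
  qed
qed

lemma weyl_coeff_weyl_D_ge:
  fixes a :: "'k::field weyl"
  assumes "a \<in> weyl_D_ge m" "weyl_coeff a (i, j) \<noteq> 0"
  shows "int j - int i \<ge> m"
proof -
  have D: "int j - int i = t" if "b \<in> weyl_D t" "weyl_coeff b (i, j) \<noteq> 0"
    for b :: "'k weyl" and t
    using that unfolding weyl_D_def
  proof (induction rule: weyl.span_induct_alt)
    case (step c x y)
    from step(1) obtain i' s where x: "x = weyl_monom (i', s)" "int s - int i' = t"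
      by (auto simp: weyl_monom_def)
    show ?case
    proof (cases "(i, j) = (i', s)")
      case True
      then show ?thesis using x(2) by simp
    next
      case False
      then have "weyl_coeff y (i, j) \<noteq> 0"
        using step(3)
        by (simp add: x(1) weyl_coeff_add weyl_coeff_scale weyl_coeff_monom split: if_splits)
      then show ?thesis by (rule step(2))
    qed
  qed simp
  show ?thesis
    using assms unfolding weyl_D_ge_def
  proof (induction rule: weyl.span_induct_alt)
    case (step c x y)
    then obtain t where t: "t \<ge> m" "x \<in> weyl_D t" by auto
    from step(3) have "weyl_coeff x (i, j) \<noteq> 0 \<or> weyl_coeff y (i, j) \<noteq> 0"
      by (auto simp: weyl_coeff_add weyl_coeff_scale)
    then show ?case
    proof
      assume "weyl_coeff x (i, j) \<noteq> 0"
      with D[OF t(2)] t(1) show ?thesis by simp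
    qed (rule step(2))
  qed simp
qed

text \<open>
  When \<open>z\<close> has only nonnegative degrees, subtracting its constant term leaves the commutator unchanged. By the constant
  term of the commutator, \<open>w\<close> contains some \<open>p^m\<close> with \<open>m > 0\<close>, hence a negative degree, and
  comparison of leading monomials shows that \<open>z\<close> starts with \<open>q\<close> and \<open>w\<close> with \<open>p\<close>. Then \<open>w\<close> and \<open>-z\<close>
  take the parts of \<open>P\<close> and \<open>Q\<close>.
\<close>

lemma subalgebra_of_commutator_one_eq_UNIV:
  fixes z w :: "'k::field_char_0 weyl"
  assumes S: "weyl_subalgebra S" and mem: "z \<in> S" "w \<in> S"
    and comm: "z * w - w * z = 1"
    and z: "\<And>i j. weyl_coeff z (i, j) \<noteq> 0 \<Longrightarrow> i \<le> j + 1"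
  shows "S = UNIV"
proof -
  have "z \<noteq> 0" "w \<noteq> 0" using comm by auto
  then obtain i j k l where lz: "leading 1 (- 1) z i j" and lw: "leading 1 (- 1) w k l"
    using leading_exists by metis
  show ?thesis
  proof (cases "i = j + 1")
    case True
    show ?thesis
      by (rule generates_of_degree_minus_one_part[OF S mem(1) z _ mem(2) comm lw])
        (use lz True in auto)
  next
    case False
    with z[OF leading_nonzero[OF lz]] have "i \<le> j" by simp
    then have z0: "i' \<le> j'" if "weyl_coeff z (i', j') \<noteq> 0" for i' j'
      using leading_weight_le[OF lz that] by simp
    define z' where "z' = z - weyl_scale (weyl_coeff z (0, 0)) 1"
    have coeff: "weyl_coeff z' x = (if x = (0, 0) then 0 else weyl_coeff z x)" for x
      by (simp add: z'_def weyl_coeff_diff weyl_coeff_scale weyl_coeff_one)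
    have comm': "z' * w - w * z' = 1"
      using comm by (simp add: z'_def right_diff_distrib left_diff_distrib weyl_scale_mult_left
          weyl_scale_mult_right)
    have z'S: "z' \<in> S"
      using S weyl_subalgebra_scale[OF S] weyl_subalgebra_diff[OF S mem(1)]
      by (simp add: z'_def weyl_subalgebra_def)
    have "z' \<noteq> 0" using comm' by auto
    then obtain i1 j1 where lz': "leading 1 (- 1) z' i1 j1" by (rule leading_exists)
    have ij: "i1 \<le> j1" "(i1, j1) \<noteq> (0, 0)"
      using leading_nonzero[OF lz'] z0[of i1 j1] by (auto simp: coeff split: if_splits)
    obtain m where m: "m \<ge> 1"
      "weyl_coeff z' (0, m) \<noteq> 0 \<and> weyl_coeff w (m, 0) \<noteq> 0 \<or>
       weyl_coeff z' (m, 0) \<noteq> 0 \<and> weyl_coeff w (0, m) \<noteq> 0"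
      using commutator_constant_term[OF comm'] by blast
    then have "weyl_coeff w (m, 0) \<noteq> 0"
      using z0[of m 0] by (auto simp: coeff split: if_splits)
    from leading_weight_le[OF lw this] m(1) have kl: "l < k" by simp
    have "i1 * l \<noteq> j1 * k"
    proof
      assume eq: "i1 * l = j1 * k"
      have "i1 * l \<le> j1 * l" using ij(1) by simp
      moreover have "j1 > 0" using ij by (cases j1) auto
      then have "j1 * l < j1 * k" using kl by simp
      ultimately show False using eq by simp
    qed
    with leading_commutator_one[OF comm' lz' lw] kl
    have vals: "i1 = 0" "j1 = 1" "k = 1" "l = 0" by auto
    have "w * (- z') - (- z') * w = 1" using comm' by simp
    moreover have "- z' \<in> S"
      using weyl_subalgebra_diff[OF S _ z'S, of 0] weyl_subalgebra_diff[OF S z'S z'S] by simp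
    moreover have "i' \<le> j' + 1" if "weyl_coeff w (i', j') \<noteq> 0" for i' j'
      using leading_weight_le[OF lw that] vals by simp
    moreover have "i' + 1 \<le> j'" if "weyl_coeff (- z') (i', j') \<noteq> 0" for i' j'
      using leading_weight_le[OF lz', of i' j'] that vals by (simp add: weyl_coeff_minus)
    ultimately show ?thesis
      using commutator_one_generates_triangular[OF S mem(2)] by blast
  qed
qed

theorem corollary3p11:
  fixes z w :: "'k::field_char_0 weyl"
  assumes "z * w - w * z = 1"
    and "z \<in> weyl_D_ge (- 1)"
  shows "weyl_generate {z, w} = UNIV"
proof -
  have z: "i \<le> j + 1" if "weyl_coeff z (i, j) \<noteq> 0" for i j
    using weyl_coeff_weyl_D_ge[OF assms(2) that] by simp
  have "S = UNIV" if "weyl_subalgebra S" "{z, w} \<subseteq> S" for S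
    using subalgebra_of_commutator_one_eq_UNIV[OF that(1) _ _ assms(1) z] that(2) by blast
  then show ?thesis unfolding weyl_generate_def hull_def by blast
qed

end
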